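(* Let $X\subseteq U\times V$ be (the edge set of) a bipartite graph on $U\cup V$ with degree sequence $(\boldsymbol{x},\boldsymbol{y})$, and define $$\widehat F=\widehat F(X)=\sum_{u_iv_j\in X}(s_i-x_i)(t_j-y_j),$$ $\hat s_{\max}=\max_{1\le i\le m}(s_i-x_i)$, $\hat t_{\max}=\max_{1\le j\le n}(t_j-y_j)$, $\widehat S=S-|X|$ and $$\hat\delta_{\max}=\hat s_{\max}\hat t_{\max}+\hat s_{\max}y_{\max}+x_{\max}\hat t_{\max}.$$ Suppose that $\hat s_{\max}+\hat t_{\max}=o(\widehat S/\log\widehat S)$, $\hat\delta_{\max}=o(\widehat S)$, $\hat\delta_{\max}\widehat F=o(\widehat S^2)$ and $\widehat F=o(\widehat S^{5/3})$. Then, as $\widehat S\to\infty$, the probability that a uniformly random element of $\mathcal{B}(\boldsymbol{s},\boldsymbol{t})$ contains every edge of $X$ is $$\frac{B(\boldsymbol{s}-\boldsymbol{x},\boldsymbol{t}-\boldsymbol{y})}{B(\boldsymbol{s},\boldsymbol{t})}\,\exp\left(-\frac{\widehat F}{\widehat S}-\frac{3\widehat F^2}{2\widehat S^3}+O\left(\frac{\hat\delta_{\max}\widehat F}{\widehat S^2}+\frac{\widehat F^3}{\widehat S^5}\right)\right).$$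
   Context: Let $U=\{u_1,\ldots,u_m\}$ and $V=\{v_1,\ldots,v_n\}$ be disjoint vertex sets. Let $\boldsymbol{s}=(s_1,\ldots,s_m)$ and $\boldsymbol{t}=(t_1,\ldots,t_n)$ be vectors of nonnegative integers with $S=\sum_i s_i=\sum_j t_j$. $\mathcal{B}(\boldsymbol{s},\boldsymbol{t})$ is the set of simple bipartite graphs with vertex bipartition $U\cup V$ in which $u_i$ has degree $s_i$ for all $i$ and $v_j$ has degree $t_j$ for all $j$; $B(\boldsymbol{s},\boldsymbol{t})=|\mathcal{B}(\boldsymbol{s},\boldsymbol{t})|$ (so the count is zero if some prescribed degree is negative). Graphs are identified with their edge sets, and the edge $\{u_i,v_j\}$ is written $u_iv_j$. Speaking of a uniformly random element of $\mathcal{B}(\boldsymbol{s},\boldsymbol{t})$ presupposes that this set is nonempty. The degree sequence $(\boldsymbol{x},\boldsymbol{y})$ of $X$ means that $u_i$ is in exactly $x_i$ edges of $X$ and $v_j$ is in exactly $y_j$ edges of $X$; $x_{\max}=\max_i x_i$, $y_{\max}=\max_j y_j$. Asymptotic convention: one considers an infinite family of instances $(m,n,\boldsymbol{s},\boldsymbol{t},X)$ along which $\widehat S\to\infty$; the $o(\cdot)$ hypotheses refer to this limit, and $O(g)$ denotes a quantity (of either sign) whose absolute value is at most a constant times $|g|$ for all sufficiently large $\widehat S$, uniformly over the family. $\log$ is the natural logarithm. *)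

theory Defs
  imports "HOL-Probability.Probability" "HOL-Library.Landau_Symbols"
begin

text \<open>
  A bipartite graph on \<open>U = {u\<^sub>1, \<dots>, u\<^sub>m}\<close> and \<open>V = {v\<^sub>1, \<dots>, v\<^sub>n}\<close> is identified with
  its edge set, a subset of \<open>{1..m} \<times> {1..n}\<close>; the pair \<open>(i, j)\<close> stands for the edge
  \<open>u\<^sub>i v\<^sub>j\<close>, so \<open>U\<close> and \<open>V\<close> are disjoint by construction. Degree vectors are functions of
  which only the values on \<open>{1..m}\<close>, respectively \<open>{1..n}\<close>, matter.
\<close>

definition udeg :: "(nat \<times> nat) set \<Rightarrow> nat \<Rightarrow> nat" where
  "udeg G i = card {j. (i, j) \<in> G}"

definition vdeg :: "(nat \<times> nat) set \<Rightarrow> nat \<Rightarrow> nat" where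
  "vdeg G j = card {i. (i, j) \<in> G}"

text \<open>
  The prescribed degrees are integers, so that \<open>s - x\<close> is not truncated; the set is
  empty as soon as a prescribed degree is negative.
\<close>

definition bip_graphs ::
    "nat \<Rightarrow> nat \<Rightarrow> (nat \<Rightarrow> int) \<Rightarrow> (nat \<Rightarrow> int) \<Rightarrow> (nat \<times> nat) set set" where
  "bip_graphs m n s t =
     {G. G \<subseteq> {1..m} \<times> {1..n} \<and>
         (\<forall>i\<in>{1..m}. int (udeg G i) = s i) \<and>
         (\<forall>j\<in>{1..n}. int (vdeg G j) = t j)}"

definition num_bip_graphs ::
    "nat \<Rightarrow> nat \<Rightarrow> (nat \<Rightarrow> int) \<Rightarrow> (nat \<Rightarrow> int) \<Rightarrow> nat" where
  "num_bip_graphs m n s t = card (bip_graphs m n s t)"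

lemma finite_bip_graphs: "finite (bip_graphs m n s t)"
  by (rule finite_subset[of _ "Pow ({1..m} \<times> {1..n})"]) (auto simp: bip_graphs_def)

definition s_res :: "(nat \<Rightarrow> nat) \<Rightarrow> (nat \<times> nat) set \<Rightarrow> nat \<Rightarrow> int" where
  "s_res s X i = int (s i) - int (udeg X i)"

definition t_res :: "(nat \<Rightarrow> nat) \<Rightarrow> (nat \<times> nat) set \<Rightarrow> nat \<Rightarrow> int" where
  "t_res t X j = int (t j) - int (vdeg X j)"

definition F_hat ::
    "(nat \<Rightarrow> nat) \<Rightarrow> (nat \<Rightarrow> nat) \<Rightarrow> (nat \<times> nat) set \<Rightarrow> real" where
  "F_hat s t X = (\<Sum>(i, j)\<in>X. real_of_int (s_res s X i) * real_of_int (t_res t X j))"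

definition S_hat :: "nat \<Rightarrow> (nat \<Rightarrow> nat) \<Rightarrow> (nat \<times> nat) set \<Rightarrow> real" where
  "S_hat m s X = real (\<Sum>i=1..m. s i) - real (card X)"

text \<open>
  The maxima below are unspecified for \<open>m = 0\<close> or \<open>n = 0\<close>; no vertex set is empty when
  \<open>S_hat\<close> is positive and both degree sums agree.
\<close>

definition s_hat_max :: "nat \<Rightarrow> (nat \<Rightarrow> nat) \<Rightarrow> (nat \<times> nat) set \<Rightarrow> real" where
  "s_hat_max m s X = real_of_int (Max (s_res s X ` {1..m}))"

definition t_hat_max :: "nat \<Rightarrow> (nat \<Rightarrow> nat) \<Rightarrow> (nat \<times> nat) set \<Rightarrow> real" where
  "t_hat_max n t X = real_of_int (Max (t_res t X ` {1..n}))"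

definition x_max :: "nat \<Rightarrow> (nat \<times> nat) set \<Rightarrow> real" where
  "x_max m X = real (Max (udeg X ` {1..m}))"

definition y_max :: "nat \<Rightarrow> (nat \<times> nat) set \<Rightarrow> real" where
  "y_max n X = real (Max (vdeg X ` {1..n}))"

definition delta_hat_max ::
    "nat \<Rightarrow> nat \<Rightarrow> (nat \<Rightarrow> nat) \<Rightarrow> (nat \<Rightarrow> nat) \<Rightarrow> (nat \<times> nat) set \<Rightarrow> real" where
  "delta_hat_max m n s t X =
     s_hat_max m s X * t_hat_max n t X + s_hat_max m s X * y_max n X
       + x_max m X * t_hat_max n t X"

end

theory Submission imports Defs begin

text \<open>
  Write \<open>a = s - x\<close> and \<open>b = t - y\<close> for the residual degrees, \<open>N\<close> for their common sum and \<open>\<delta>\<close>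
  for \<open>delta_hat_max\<close>. Deleting \<open>X\<close> turns the probability into \<open>B(a, b) / B(s, t)\<close> times the
  probability that a random graph with degrees \<open>(a, b)\<close> avoids \<open>X\<close>. The latter is revealed one
  edge of \<open>X\<close> at a time: switching \<open>{ij, kl}\<close> to \<open>{il, kj}\<close> shows that, conditionally on the
  previous edges being avoided, the edge \<open>ij\<close> is present with probability
  \<open>a\<^sub>i b\<^sub>j / N \<sqdot> (1 + O(\<delta> / N))\<close>. Summing the logarithms of the complementary probabilities gives
  \<open>- F / N + O(\<delta> F / N\<^sup>2)\<close>. Since \<open>F \<le> N \<delta>\<close>, the term \<open>3 F\<^sup>2 / (2 N\<^sup>3)\<close> is itself of order
  \<open>\<delta> F / N\<^sup>2\<close>.
\<close>

section \<open>Switchings and their effect on degrees\<close>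

definition switch :: "nat \<Rightarrow> nat \<Rightarrow> nat \<Rightarrow> nat \<Rightarrow> (nat \<times> nat) set \<Rightarrow> (nat \<times> nat) set" where
  "switch i j k l H = (H - {(i, j), (k, l)}) \<union> {(i, l), (k, j)}"

lemma udeg_finite:
  assumes "finite H"
  shows "finite {j. (i, j) \<in> H}"
  by (rule finite_subset[of _ "snd ` H"]) (use assms in force)+

lemma vdeg_finite:
  assumes "finite H"
  shows "finite {i. (i, j) \<in> H}"
  by (rule finite_subset[of _ "fst ` H"]) (use assms in force)+

text \<open>Transposing a graph exchanges the two sides of the bipartition. Together with
  \<open>converse_switch\<close> this yields each fact about \<open>vdeg\<close> from its
  counterpart about \<open>udeg\<close>.\<close>

lemma vdeg_converse: "vdeg H j = udeg (H\<inverse>) j"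
  by (simp add: vdeg_def udeg_def)

lemma converse_switch: "(switch i j k l H)\<inverse> = switch j i l k (H\<inverse>)"
  by (auto simp: switch_def)

text \<open>Only the rows i and k are touched. In each of them one neighbour is exchanged for a new
  one: l replaces j in row i, and j replaces l in row k.\<close>

lemma udeg_switch:
  assumes "finite H" "(i, j) \<in> H" "(k, l) \<in> H" "(i, l) \<notin> H" "(k, j) \<notin> H"
  shows "udeg (switch i j k l H) p = udeg H p"
proof -
  have ne: "i \<noteq> k" "j \<noteq> l" using assms by auto
  have exch: "card (insert u (A - {v})) = card A" if "finite A" "v \<in> A" "u \<notin> A" for A :: "nat set" and u v
    using that card_Suc_Diff1[of A v] by (simp add: card_insert_if)
  have fin: "finite {q. (r, q) \<in> H}" for r by (rule udeg_finite[OF assms(1)])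
  consider "p = i" | "p = k" "p \<noteq> i" | "p \<noteq> i" "p \<noteq> k" by auto
  then show ?thesis
  proof cases
    case 1
    have "{q. (i, q) \<in> switch i j k l H} = insert l ({q. (i, q) \<in> H} - {j})"
      using ne by (auto simp: switch_def)
    then show ?thesis using 1 exch[OF fin, of j i l] assms by (simp add: udeg_def)
  next
    case 2
    have "{q. (k, q) \<in> switch i j k l H} = insert j ({q. (k, q) \<in> H} - {l})"
      using ne by (auto simp: switch_def)
    then show ?thesis using 2 exch[OF fin, of l k j] assms by (simp add: udeg_def)
  next
    case 3
    then have "{q. (p, q) \<in> switch i j k l H} = {q. (p, q) \<in> H}"
      by (auto simp: switch_def)
    then show ?thesis by (simp add: udeg_def)
  qed
qed

lemma vdeg_switch:
  assumes "finite H" "(i, j) \<in> H" "(k, l) \<in> H" "(i, l) \<notin> H" "(k, j) \<notin> H"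
  shows "vdeg (switch i j k l H) p = vdeg H p"
  unfolding vdeg_converse converse_switch
  by (rule udeg_switch) (use assms in auto)

lemma bip_graphs_finite_graph: "H \<in> bip_graphs m n s t \<Longrightarrow> finite H"
  by (rule finite_subset[of _ "{1..m} \<times> {1..n}"]) (auto simp: bip_graphs_def)

lemma switch_bip_graphs:
  assumes H: "H \<in> bip_graphs m n s t"
    and "(i, j) \<in> H" "(k, l) \<in> H" "(i, l) \<notin> H" "(k, j) \<notin> H"
  shows "switch i j k l H \<in> bip_graphs m n s t"
proof -
  have "switch i j k l H \<subseteq> {1..m} \<times> {1..n}"
    using assms by (auto simp: bip_graphs_def switch_def)
  then show ?thesis
    using H udeg_switch[OF bip_graphs_finite_graph[OF H] assms(2-)]
      vdeg_switch[OF bip_graphs_finite_graph[OF H] assms(2-)]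
    by (simp add: bip_graphs_def)
qed

text \<open>The inverse of a switching is again a switching, with j and l interchanged, so the one
  function \<open>switch\<close> serves both directions of the double count.\<close>

lemma switch_switch:
  assumes "(i, j) \<in> H" "(k, l) \<in> H" "(i, l) \<notin> H" "(k, j) \<notin> H"
  shows "switch i l k j (switch i j k l H) = H"
  using assms by (auto simp: switch_def)

section \<open>Counting edges through degrees\<close>

lemma card_eq_sum_udeg:
  assumes "H \<subseteq> {1..m} \<times> {1..n}"
  shows "card H = (\<Sum>i=1..m. udeg H i)"
proof -
  have "finite H" using assms by (rule finite_subset) auto
  have "H = Sigma {1..m} (\<lambda>i. {j. (i, j) \<in> H})" using assms by auto
  then have "card H = card (Sigma {1..m} (\<lambda>i. {j. (i, j) \<in> H}))" by simp
  also have "\<dots> = (\<Sum>i=1..m. udeg H i)"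
    using udeg_finite[OF \<open>finite H\<close>] by (simp add: udeg_def)
  finally show ?thesis .
qed

lemma card_eq_sum_vdeg:
  assumes "H \<subseteq> {1..m} \<times> {1..n}"
  shows "card H = (\<Sum>j=1..n. vdeg H j)"
proof -
  have "card H = card (H\<inverse>)" by simp
  also have "\<dots> = (\<Sum>j=1..n. vdeg H j)"
    unfolding vdeg_converse by (rule card_eq_sum_udeg) (use assms in auto)
  finally show ?thesis .
qed

lemma udeg_mono: "finite B \<Longrightarrow> A \<subseteq> B \<Longrightarrow> udeg A i \<le> udeg B i"
  unfolding udeg_def by (rule card_mono[OF udeg_finite]) auto

lemma vdeg_mono: "finite B \<Longrightarrow> A \<subseteq> B \<Longrightarrow> vdeg A i \<le> vdeg B i"
  unfolding vdeg_def by (rule card_mono[OF vdeg_finite]) auto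

lemma udeg_Un_disjoint:
  assumes "finite A" "finite B" "A \<inter> B = {}"
  shows "udeg (A \<union> B) i = udeg A i + udeg B i"
proof -
  have "{j. (i, j) \<in> A \<union> B} = {j. (i, j) \<in> A} \<union> {j. (i, j) \<in> B}" by auto
  then show ?thesis
    unfolding udeg_def using assms
    by (simp only:) (rule card_Un_disjoint, auto intro: udeg_finite)
qed

lemma vdeg_Un_disjoint:
  assumes "finite A" "finite B" "A \<inter> B = {}"
  shows "vdeg (A \<union> B) i = vdeg A i + vdeg B i"
  unfolding vdeg_converse converse_Un by (rule udeg_Un_disjoint) (use assms in auto)

text \<open>This and \<open>card_edges_from_le\<close> bound the number of edges kl that cannot take
  part in a forward switching because one endpoint is blocked.\<close>

lemma card_edges_into_le:
  assumes "finite H" "finite L" "\<And>l. l \<in> L \<Longrightarrow> vdeg H l \<le> \<beta>"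
  shows "card {(k, l) \<in> H. l \<in> L} \<le> card L * \<beta>"
proof -
  have "{(k, l) \<in> H. l \<in> L} = (\<Union>l\<in>L. (\<lambda>k. (k, l)) ` {k. (k, l) \<in> H})" by auto
  then have "card {(k, l) \<in> H. l \<in> L} \<le> (\<Sum>l\<in>L. card ((\<lambda>k. (k, l)) ` {k. (k, l) \<in> H}))"
    using card_UN_le[OF assms(2)] by simp
  also have "\<dots> \<le> (\<Sum>l\<in>L. \<beta>)"
  proof (rule sum_mono)
    fix l assume "l \<in> L"
    have "card ((\<lambda>k. (k, l)) ` {k. (k, l) \<in> H}) \<le> vdeg H l"
      unfolding vdeg_def by (rule card_image_le[OF vdeg_finite[OF assms(1)]])
    then show "card ((\<lambda>k. (k, l)) ` {k. (k, l) \<in> H}) \<le> \<beta>"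
      using assms(3)[OF \<open>l \<in> L\<close>] by linarith
  qed
  finally show ?thesis by simp
qed

lemma card_edges_from_le:
  assumes "finite H" "finite K" "\<And>k. k \<in> K \<Longrightarrow> udeg H k \<le> \<alpha>"
  shows "card {(k, l) \<in> H. k \<in> K} \<le> card K * \<alpha>"
proof -
  have "{(k, l) \<in> H. k \<in> K} = {(l, k) \<in> H\<inverse>. k \<in> K}\<inverse>" by auto
  then have "card {(k, l) \<in> H. k \<in> K} = card {(l, k) \<in> H\<inverse>. k \<in> K}"
    by (simp only: card_inverse)
  also have "\<dots> \<le> card K * \<alpha>"
    by (rule card_edges_into_le[OF _ assms(2)]) (use assms(1,3) in \<open>simp_all add: vdeg_converse\<close>)
  finally show ?thesis .
qed

section \<open>Graphs with the residual degrees that avoid a set of edges\<close>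

locale bipartite_degrees =
  fixes m n :: nat and a b :: "nat \<Rightarrow> nat" and \<alpha> \<beta> \<xi> \<eta> :: nat and X :: "(nat \<times> nat) set"
  assumes X_sub: "X \<subseteq> {1..m} \<times> {1..n}"
    and a_le: "\<And>i. i \<in> {1..m} \<Longrightarrow> a i \<le> \<alpha>"
    and b_le: "\<And>j. j \<in> {1..n} \<Longrightarrow> b j \<le> \<beta>"
    and x_le: "\<And>i. i \<in> {1..m} \<Longrightarrow> udeg X i \<le> \<xi>"
    and y_le: "\<And>j. j \<in> {1..n} \<Longrightarrow> vdeg X j \<le> \<eta>"
begin

definition N :: nat where "N = (\<Sum>i=1..m. a i)"

text \<open>The counterpart of \<open>delta_hat_max\<close> over the natural numbers; the two agree
  once \<alpha>, \<beta>, \<xi>, \<eta> are chosen as the maxima.\<close>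

definition D :: nat where "D = \<alpha> * \<beta> + \<alpha> * \<eta> + \<xi> * \<beta>"

definition avoiding :: "(nat \<times> nat) set \<Rightarrow> (nat \<times> nat) set set" where
  "avoiding Z = {H \<in> bip_graphs m n (\<lambda>i. int (a i)) (\<lambda>j. int (b j)). H \<inter> Z = {}}"

definition count :: "(nat \<times> nat) set \<Rightarrow> (nat \<times> nat) set \<Rightarrow> nat" where
  "count Z Y = card {H \<in> avoiding Z. Y \<subseteq> H}"

lemma edge_weight_le:
  assumes "i \<in> {1..m}" "j \<in> {1..n}"
  shows "a i * b j \<le> D"
proof -
  have "a i * b j \<le> \<alpha> * \<beta>" using a_le[OF assms(1)] b_le[OF assms(2)] by (rule mult_mono) auto
  then show ?thesis by (simp add: D_def)
qed

lemma finite_X: "finite X"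
  using X_sub by (rule finite_subset) auto

lemma finite_avoiding: "finite (avoiding Z)"
  by (simp add: avoiding_def finite_bip_graphs)

lemma avoidingD:
  assumes "H \<in> avoiding Z"
  shows "finite H" "H \<subseteq> {1..m} \<times> {1..n}" "H \<inter> Z = {}" "card H = N"
    "\<And>i. i \<in> {1..m} \<Longrightarrow> udeg H i = a i" "\<And>j. j \<in> {1..n} \<Longrightarrow> vdeg H j = b j"
proof -
  have H: "H \<in> bip_graphs m n (\<lambda>i. int (a i)) (\<lambda>j. int (b j))"
    using assms by (simp add: avoiding_def)
  show "finite H" by (rule bip_graphs_finite_graph[OF H])
  show sub: "H \<subseteq> {1..m} \<times> {1..n}" using H by (simp add: bip_graphs_def)
  show "H \<inter> Z = {}" using assms by (simp add: avoiding_def)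
  show u: "\<And>i. i \<in> {1..m} \<Longrightarrow> udeg H i = a i" and "\<And>j. j \<in> {1..n} \<Longrightarrow> vdeg H j = b j"
    using H by (simp_all add: bip_graphs_def)
  show "card H = N" using card_eq_sum_udeg[OF sub] u by (simp add: N_def)
qed

section \<open>Forward and reverse switchings\<close>

lemma switch_avoiding:
  assumes "H \<in> avoiding Z" "(i, j) \<in> H" "(k, l) \<in> H" "(i, l) \<notin> H \<union> Z" "(k, j) \<notin> H \<union> Z"
  shows "switch i j k l H \<in> avoiding Z"
proof -
  have "switch i j k l H \<in> bip_graphs m n (\<lambda>i. int (a i)) (\<lambda>j. int (b j))"
    by (rule switch_bip_graphs) (use assms in \<open>simp_all add: avoiding_def\<close>)
  moreover have "switch i j k l H \<inter> Z = {}"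
    using assms by (auto simp: avoiding_def switch_def)
  ultimately show ?thesis by (simp add: avoiding_def)
qed

text \<open>\<open>Y\<close> collects edges that must survive. For a graph containing ij, a forward
  switching deletes ij and kl, so kl is drawn from outside \<open>Y\<close>, while il and kj must be
  free to be added.\<close>

definition fwd where
  "fwd Z Y i j H = {(k, l) \<in> H - Y. (i, l) \<notin> H \<union> Z \<and> (k, j) \<notin> H \<union> Z}"

text \<open>Here kl is a non-edge about to be created. Recording a reverse switching by (k, l) gives
  it the same label as the forward switching that it undoes.\<close>

definition rev where
  "rev Z Y i j H = {(k, l). (i, l) \<in> H - Y \<and> (k, j) \<in> H - Y \<and> (k, l) \<notin> H \<union> Z}"

lemma finite_fwd: "H \<in> avoiding Z \<Longrightarrow> finite (fwd Z Y i j H)"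
  by (rule finite_subset[of _ H]) (auto simp: fwd_def avoidingD)

lemma pairs_eq_Times:
  "{(k, l). (i, l) \<in> H \<and> (k, j) \<in> H} = {k. (k, j) \<in> H} \<times> {l. (i, l) \<in> H}"
  by auto

lemma finite_pairs: "finite H \<Longrightarrow> finite {(k, l). (i, l) \<in> H \<and> (k, j) \<in> H}"
  by (simp add: pairs_eq_Times udeg_finite vdeg_finite)

lemma finite_rev:
  assumes "H \<in> avoiding Z"
  shows "finite (rev Z Y i j H)"
  by (rule finite_subset[OF _ finite_pairs[OF avoidingD(1)[OF assms]]]) (auto simp: rev_def)

text \<open>Switching while keeping the label (k, l) is a bijection between pairs (graph with ij,
  forward switching) and pairs (graph without ij, reverse switching). The conditions on
  \<open>Z\<close> and \<open>Y\<close> in \<open>fwd\<close> and \<open>rev\<close> keep both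
  directions within the graphs that avoid \<open>Z\<close> and contain \<open>Y\<close>.\<close>

lemma switching_double_count:
  assumes e: "(i, j) \<notin> Z" "(i, j) \<notin> Y"
  shows "(\<Sum>H | H \<in> avoiding Z \<and> Y \<subseteq> H \<and> (i, j) \<in> H. card (fwd Z Y i j H))
       = (\<Sum>H | H \<in> avoiding Z \<and> Y \<subseteq> H \<and> (i, j) \<notin> H. card (rev Z Y i j H))"
proof -
  let ?A = "{H. H \<in> avoiding Z \<and> Y \<subseteq> H \<and> (i, j) \<in> H}"
  let ?B = "{H. H \<in> avoiding Z \<and> Y \<subseteq> H \<and> (i, j) \<notin> H}"
  let ?f = "\<lambda>(H, k, l). (switch i j k l H, k, l)"
  let ?g = "\<lambda>(H, k, l). (switch i l k j H, k, l)"
  have "bij_betw ?f (Sigma ?A (fwd Z Y i j)) (Sigma ?B (rev Z Y i j))"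
  proof (rule bij_betw_byWitness[where f' = ?g])
    show "\<forall>p\<in>Sigma ?A (fwd Z Y i j). ?g (?f p) = p"
      by (auto simp: fwd_def switch_switch)
    show "\<forall>p\<in>Sigma ?B (rev Z Y i j). ?f (?g p) = p"
      by (auto simp: rev_def switch_switch)
    show "?f ` Sigma ?A (fwd Z Y i j) \<subseteq> Sigma ?B (rev Z Y i j)"
    proof safe
      fix H k l assume H: "H \<in> avoiding Z" "Y \<subseteq> H" "(i, j) \<in> H" and "(k, l) \<in> fwd Z Y i j H"
      then have kl: "(k, l) \<in> H" "(k, l) \<notin> Y" "(i, l) \<notin> H \<union> Z" "(k, j) \<notin> H \<union> Z"
        by (auto simp: fwd_def)
      have ne: "i \<noteq> k" "j \<noteq> l" using H kl by auto
      show "switch i j k l H \<in> avoiding Z" by (rule switch_avoiding) (use H kl in auto)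
      show "(p, q) \<in> switch i j k l H" if "(p, q) \<in> Y" for p q
        using that H kl e by (auto simp: switch_def)
      show False if "(i, j) \<in> switch i j k l H" using that ne by (auto simp: switch_def)
      show "(k, l) \<in> rev Z Y i j (switch i j k l H)"
        using H kl ne avoidingD(3)[OF H(1)] by (auto simp: rev_def switch_def)
    qed
    show "?g ` Sigma ?B (rev Z Y i j) \<subseteq> Sigma ?A (fwd Z Y i j)"
    proof safe
      fix H k l assume H: "H \<in> avoiding Z" "Y \<subseteq> H" "(i, j) \<notin> H" and "(k, l) \<in> rev Z Y i j H"
      then have kl: "(i, l) \<in> H" "(k, j) \<in> H" "(i, l) \<notin> Y" "(k, j) \<notin> Y" "(k, l) \<notin> H \<union> Z"
        by (auto simp: rev_def)
      have ne: "i \<noteq> k" "j \<noteq> l" using H kl by auto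
      show "switch i l k j H \<in> avoiding Z" by (rule switch_avoiding) (use H kl e in auto)
      show "(p, q) \<in> switch i l k j H" if "(p, q) \<in> Y" for p q
        using that H kl e by (auto simp: switch_def)
      show "(i, j) \<in> switch i l k j H" by (auto simp: switch_def)
      show "(k, l) \<in> fwd Z Y i j (switch i l k j H)"
        using H kl ne avoidingD(3)[OF H(1)] by (auto simp: fwd_def switch_def)
    qed
  qed
  then have "card (Sigma ?A (fwd Z Y i j)) = card (Sigma ?B (rev Z Y i j))"
    by (rule bij_betw_same_card)
  then show ?thesis
    using finite_fwd finite_rev finite_avoiding by simp
qed

text \<open>Of the N edges kl, those in \<open>Y\<close> are lost, and so are those with l adjacent
  to i, or k adjacent to j, in H \<union> Z. There are at most \<alpha> + \<xi> such l, each on at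
  most \<beta> edges, and at most \<beta> + \<eta> such k, each on at most \<alpha> edges. The loss
  from the endpoints is thus at most D + \<alpha>\<beta>, hence at most 2D.\<close>

lemma fwd_card_ge:
  assumes H: "H \<in> avoiding Z" and Z: "Z \<subseteq> X" and ij: "i \<in> {1..m}" "j \<in> {1..n}" and Y: "finite Y"
  shows "N \<le> card (fwd Z Y i j H) + card Y + 2 * D"
proof -
  note Hd = avoidingD[OF H]
  have finZ: "finite Z" using Z finite_X finite_subset by blast
  have HZ: "finite (H \<union> Z)" using Hd(1) finZ by simp
  let ?L = "{l. (i, l) \<in> H \<union> Z}" and ?K = "{k. (k, j) \<in> H \<union> Z}"
  have L: "card ?L \<le> \<alpha> + \<xi>"
    using udeg_Un_disjoint[OF Hd(1) finZ Hd(3), of i] Hd(5)[OF ij(1)] a_le[OF ij(1)]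
      udeg_mono[OF finite_X Z, of i] x_le[OF ij(1)]
    by (simp add: udeg_def)
  have K: "card ?K \<le> \<beta> + \<eta>"
    using vdeg_Un_disjoint[OF Hd(1) finZ Hd(3), of j] Hd(6)[OF ij(2)] b_le[OF ij(2)]
      vdeg_mono[OF finite_X Z, of j] y_le[OF ij(2)]
    by (simp add: vdeg_def)
  have sub: "?L \<subseteq> {1..n}" "?K \<subseteq> {1..m}" using Hd(2) Z X_sub by auto
  have bad1: "card {(k, l) \<in> H. l \<in> ?L} \<le> card ?L * \<beta>"
    by (rule card_edges_into_le[OF Hd(1) udeg_finite[OF HZ]]) (use sub Hd(6) b_le in auto)
  have bad2: "card {(k, l) \<in> H. k \<in> ?K} \<le> card ?K * \<alpha>"
    by (rule card_edges_from_le[OF Hd(1) vdeg_finite[OF HZ]]) (use sub Hd(5) a_le in auto)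
  have "H \<subseteq> fwd Z Y i j H \<union> Y \<union> ({(k, l) \<in> H. l \<in> ?L} \<union> {(k, l) \<in> H. k \<in> ?K})"
    by (auto simp: fwd_def)
  then have "card H \<le> card (fwd Z Y i j H \<union> Y \<union> ({(k, l) \<in> H. l \<in> ?L} \<union> {(k, l) \<in> H. k \<in> ?K}))"
    using finite_fwd[OF H, of Y i j] Y Hd(1)
    by (intro card_mono) (auto intro: finite_subset[of _ H])
  also have "\<dots> \<le> card (fwd Z Y i j H \<union> Y) + card ({(k, l) \<in> H. l \<in> ?L} \<union> {(k, l) \<in> H. k \<in> ?K})"
    by (rule card_Un_le)
  also have "\<dots> \<le> (card (fwd Z Y i j H) + card Y)
      + (card {(k, l) \<in> H. l \<in> ?L} + card {(k, l) \<in> H. k \<in> ?K})"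
    by (intro add_mono card_Un_le)
  also have "\<dots> \<le> (card (fwd Z Y i j H) + card Y) + ((\<alpha> + \<xi>) * \<beta> + (\<beta> + \<eta>) * \<alpha>)"
    using bad1 bad2 mult_right_mono[OF L, of \<beta>] mult_right_mono[OF K, of \<alpha>] by linarith
  also have "(\<alpha> + \<xi>) * \<beta> + (\<beta> + \<eta>) * \<alpha> \<le> 2 * D" by (simp add: D_def algebra_simps)
  finally show ?thesis using Hd(4) by simp
qed

section \<open>Upper bounds for graphs containing up to three given edges\<close>

lemma card_pairs:
  assumes "H \<in> avoiding Z" "i \<in> {1..m}" "j \<in> {1..n}"
  shows "card {(k, l). (i, l) \<in> H \<and> (k, j) \<in> H} = a i * b j"
  using avoidingD(5)[OF assms(1,2)] avoidingD(6)[OF assms(1,3)]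
  by (simp only: pairs_eq_Times card_cartesian_product udeg_def vdeg_def mult.commute)

text \<open>
  Forcing a further set \<open>Y\<close> of edges to be present costs only \<open>card Y\<close> forward switchings. Applied
  to two and three edges, this bounds the number of pairs \<open>(il, kj)\<close> that cannot be switched back
  because \<open>kl\<close> is an edge or forbidden; pointwise these pairs may be as numerous as \<open>a i * \<beta>\<close>.
\<close>

lemma count_insert_le:
  assumes Z: "Z \<subseteq> X" and ij: "i \<in> {1..m}" "j \<in> {1..n}" and Y: "finite Y" and e: "(i, j) \<notin> Y"
  shows "count Z (insert (i, j) Y) * (N - card Y - 2 * D) \<le> count Z Y * (a i * b j)"
proof (cases "(i, j) \<in> Z")
  case True
  then have "{H \<in> avoiding Z. insert (i, j) Y \<subseteq> H} = {}" using avoidingD(3) by auto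
  then show ?thesis by (simp only: count_def card.empty mult_0)
next
  case False
  let ?A = "{H. H \<in> avoiding Z \<and> Y \<subseteq> H \<and> (i, j) \<in> H}"
  let ?B = "{H. H \<in> avoiding Z \<and> Y \<subseteq> H \<and> (i, j) \<notin> H}"
  have "count Z (insert (i, j) Y) = card ?A"
    unfolding count_def by (rule arg_cong[of _ _ card]) auto
  then have "count Z (insert (i, j) Y) * (N - card Y - 2 * D) = (\<Sum>H\<in>?A. N - card Y - 2 * D)"
    by simp
  also have "\<dots> \<le> (\<Sum>H\<in>?A. card (fwd Z Y i j H))"
  proof (rule sum_mono)
    fix H assume "H \<in> ?A"
    then have "N \<le> card (fwd Z Y i j H) + card Y + 2 * D"
      using fwd_card_ge[OF _ Z ij Y] by simp
    \<comment> \<open>Subtraction is truncated here: if card Y + 2D exceeds N, the left side is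
      0.\<close>
    then show "N - card Y - 2 * D \<le> card (fwd Z Y i j H)" by simp
  qed
  also have "\<dots> = (\<Sum>H\<in>?B. card (rev Z Y i j H))"
    by (rule switching_double_count[OF False e])
  also have "\<dots> \<le> (\<Sum>H\<in>?B. a i * b j)"
  proof (rule sum_mono)
    fix H assume "H \<in> ?B"
    then have H: "H \<in> avoiding Z" by simp
    have "card (rev Z Y i j H) \<le> card {(k, l). (i, l) \<in> H \<and> (k, j) \<in> H}"
      by (rule card_mono[OF finite_pairs[OF avoidingD(1)[OF H]]]) (auto simp: rev_def)
    then show "card (rev Z Y i j H) \<le> a i * b j" by (simp add: card_pairs[OF H ij])
  qed
  also have "\<dots> = card ?B * (a i * b j)" by simp
  also have "\<dots> \<le> count Z Y * (a i * b j)"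
    unfolding count_def by (intro mult_right_mono card_mono) (auto simp: finite_avoiding)
  finally show ?thesis .
qed

lemma count_insert_ratio:
  assumes Z: "Z \<subseteq> X" and ij: "i \<in> {1..m}" "j \<in> {1..n}" and Y: "finite Y" "card Y \<le> 2"
    and e: "(i, j) \<notin> Y" and D: "1 \<le> D" "16 * D \<le> N"
  shows "real (count Z (insert (i, j) Y)) \<le> 2 * real (a i * b j) / N * count Z Y"
proof -
  \<comment> \<open>Since card Y \<le> 2 and D \<ge> 1, twice the loss is at most 4 + 4D \<le> 8D,
    which is below N. So at least half of the edges remain available, which is the source of the
    factor 2.\<close>
  have N: "N \<le> 2 * (N - card Y - 2 * D)" using Y(2) D by linarith
  have "count Z (insert (i, j) Y) * N \<le> count Z (insert (i, j) Y) * (2 * (N - card Y - 2 * D))"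
    using N by (rule mult_left_mono) simp
  also have "\<dots> \<le> 2 * (a i * b j) * count Z Y"
    using count_insert_le[OF Z ij Y(1) e] by (simp add: mult_ac)
  finally have "real (count Z (insert (i, j) Y) * N) \<le> real (2 * (a i * b j) * count Z Y)"
    by (rule of_nat_mono)
  then show ?thesis using D by (simp add: field_simps)
qed

text \<open>Inserting the edges kj and il one at a time costs a factor 2 a_k b_j / N and a factor 2
  a_i b_l / N. The product regroups into the weight of ij times the weight of kl, the form needed
  for summing over kl.\<close>

lemma card_two_edges_le:
  assumes Z: "Z \<subseteq> X" and ij: "i \<in> {1..m}" "j \<in> {1..n}" and kl: "k \<in> {1..m}" "l \<in> {1..n}"
    and D: "1 \<le> D" "16 * D \<le> N"
  shows "real (card {H \<in> {H \<in> avoiding Z. (i, j) \<notin> H}. (i, l) \<in> H \<and> (k, j) \<in> H})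
    \<le> 4 * real (a i * b j) * real (a k * b l) / real N ^ 2 * card (avoiding Z)"
proof (cases "i = k")
  case True
  \<comment> \<open>If i = k, then kj is the edge ij, which is excluded.\<close>
  then have "{H \<in> {H \<in> avoiding Z. (i, j) \<notin> H}. (i, l) \<in> H \<and> (k, j) \<in> H} = {}" by auto
  then show ?thesis by (simp only: card.empty) simp
next
  case False
  have "real (card {H \<in> {H \<in> avoiding Z. (i, j) \<notin> H}. (i, l) \<in> H \<and> (k, j) \<in> H})
      \<le> real (count Z (insert (i, l) (insert (k, j) {})))"
    unfolding count_def by (intro of_nat_mono card_mono) (auto simp: finite_avoiding)
  also have "\<dots> \<le> 2 * real (a i * b l) / N * count Z (insert (k, j) {})"
    by (rule count_insert_ratio[OF Z]) (use ij kl D False in auto)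
  also have "\<dots> \<le> 2 * real (a i * b l) / N * (2 * real (a k * b j) / N * count Z {})"
    by (intro mult_left_mono count_insert_ratio[OF Z]) (use ij kl D in auto)
  finally show ?thesis by (simp add: count_def power2_eq_square mult_ac)
qed

text \<open>The third edge kl contributes one more factor 2 a_k b_l / N, so the weight of kl now
  appears squared.\<close>

lemma card_three_edges_le:
  assumes Z: "Z \<subseteq> X" and ij: "i \<in> {1..m}" "j \<in> {1..n}" and kl: "k \<in> {1..m}" "l \<in> {1..n}"
    and D: "1 \<le> D" "16 * D \<le> N"
  shows "real (card {H \<in> {H \<in> avoiding Z. (i, j) \<notin> H}. (i, l) \<in> H \<and> (k, j) \<in> H \<and> (k, l) \<in> H})
    \<le> 8 * real (a i * b j) * real (a k * b l) ^ 2 / real N ^ 3 * card (avoiding Z)"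
proof (cases "i = k \<or> j = l")
  case True
  \<comment> \<open>If i = k then kj is ij, and if j = l then il is ij; in both cases ij would be
    present.\<close>
  then have "{H \<in> {H \<in> avoiding Z. (i, j) \<notin> H}. (i, l) \<in> H \<and> (k, j) \<in> H \<and> (k, l) \<in> H} = {}" by auto
  then show ?thesis by (simp only: card.empty) simp
next
  case False
  have "real (card {H \<in> {H \<in> avoiding Z. (i, j) \<notin> H}. (i, l) \<in> H \<and> (k, j) \<in> H \<and> (k, l) \<in> H})
      \<le> real (count Z (insert (k, l) (insert (i, l) (insert (k, j) {}))))"
    unfolding count_def by (intro of_nat_mono card_mono) (auto simp: finite_avoiding)
  also have "\<dots> \<le> 2 * real (a k * b l) / N * count Z (insert (i, l) (insert (k, j) {}))"
    by (rule count_insert_ratio[OF Z]) (use ij kl D False in auto)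
  also have "\<dots> \<le> 2 * real (a k * b l) / N * (2 * real (a i * b l) / N * count Z (insert (k, j) {}))"
    by (intro mult_left_mono count_insert_ratio[OF Z]) (use ij kl D False in auto)
  also have "\<dots> \<le> 2 * real (a k * b l) / N * (2 * real (a i * b l) / N * (2 * real (a k * b j) / N * count Z {}))"
    by (intro mult_left_mono count_insert_ratio[OF Z]) (use ij kl D in auto)
  finally show ?thesis by (simp add: count_def power2_eq_square power3_eq_cube mult_ac)
qed

section \<open>Blocked reverse switchings on average\<close>

definition F :: "(nat \<times> nat) set \<Rightarrow> real" where
  "F Z = (\<Sum>(i, j)\<in>Z. real (a i) * real (b j))"

text \<open>Row i of X has at most \<xi> edges, each of weight at most a_i \<beta>, so it
  contributes at most a_i \<xi>\<beta> \<le> a_i D; the a_i add up to N.\<close>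

lemma F_le:
  assumes "Z \<subseteq> X"
  shows "F Z \<le> real N * real D"
proof -
  have "F Z \<le> F X"
    unfolding F_def by (rule sum_mono2[OF finite_X assms]) auto
  also have "F X = (\<Sum>(i, j)\<in>Sigma {1..m} (\<lambda>i. {j. (i, j) \<in> X}). real (a i) * real (b j))"
    unfolding F_def using X_sub by (intro sum.cong) auto
  also have "\<dots> = (\<Sum>i=1..m. \<Sum>j | (i, j) \<in> X. real (a i) * real (b j))"
    by (rule sum.Sigma[symmetric]) (auto simp: udeg_finite finite_X)
  also have "\<dots> \<le> (\<Sum>i=1..m. real (a i) * real D)"
  proof (rule sum_mono)
    fix i assume i: "i \<in> {1..m}"
    have "(\<Sum>j | (i, j) \<in> X. real (a i) * real (b j)) \<le> (\<Sum>j | (i, j) \<in> X. real (a i) * real \<beta>)"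
      by (intro sum_mono mult_left_mono of_nat_mono b_le) (use X_sub in auto)
    also have "\<dots> = real (a i) * (real (udeg X i) * real \<beta>)" by (simp add: udeg_def)
    also have "\<dots> \<le> real (a i) * (real \<xi> * real \<beta>)"
      by (intro mult_left_mono mult_right_mono of_nat_mono x_le i) auto
    also have "\<dots> \<le> real (a i) * real D" by (intro mult_left_mono) (auto simp: D_def)
    finally show "(\<Sum>j | (i, j) \<in> X. real (a i) * real (b j)) \<le> real (a i) * real D" .
  qed
  also have "\<dots> = real N * real D" by (simp add: N_def sum_distrib_right)
  finally show ?thesis .
qed

text \<open>One factor of each square is at most D by \<open>edge_weight_le\<close>; the sum of the
  other factors splits into the product of the two degree sums.\<close>

lemma sum_squares_le:
  assumes "(\<Sum>j=1..n. b j) = N"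
  shows "(\<Sum>(k, l)\<in>{1..m} \<times> {1..n}. (real (a k) * real (b l)) ^ 2) \<le> real D * real N ^ 2"
proof -
  have "(\<Sum>(k, l)\<in>{1..m} \<times> {1..n}. (real (a k) * real (b l)) ^ 2)
      \<le> (\<Sum>(k, l)\<in>{1..m} \<times> {1..n}. real D * (real (a k) * real (b l)))"
  proof (rule sum_mono, clarify)
    fix k l assume kl: "k \<in> {1..m}" "l \<in> {1..n}"
    have "real (a k) * real (b l) \<le> real D"
      unfolding of_nat_mult[symmetric] by (intro of_nat_mono edge_weight_le kl)
    then show "(real (a k) * real (b l)) ^ 2 \<le> real D * (real (a k) * real (b l))"
      unfolding power2_eq_square by (rule mult_right_mono) simp
  qed
  also have "\<dots> = real D * ((\<Sum>k=1..m. real (a k)) * (\<Sum>l=1..n. real (b l)))"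
    unfolding sum_product sum.cartesian_product by (simp add: sum_distrib_left case_prod_unfold)
  also have "(\<Sum>l=1..n. real (b l)) = real N" using assms by (metis of_nat_sum)
  finally show ?thesis by (simp add: N_def power2_eq_square)
qed

lemma sum_card_swap:
  assumes "finite A" "finite B"
  shows "(\<Sum>x\<in>A. card {y \<in> B. R x y}) = (\<Sum>y\<in>B. card {x \<in> A. R x y})"
  using sum_multicount_gen[OF assms, of R "\<lambda>y. card {x \<in> A. R x y}"] by simp

text \<open>Exchanging the sums over graphs and over pairs kl reduces the count to the two- and
  three-edge estimates. Pairs kl in \<open>Z\<close> contribute the constant 4 through
  \<open>F_le\<close>, and pairs kl that are edges contribute 8 through
  \<open>sum_squares_le\<close>, together 12.\<close>

lemma bad_reverse_switchings_le:
  assumes Z: "Z \<subseteq> X" and ij: "i \<in> {1..m}" "j \<in> {1..n}"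
    and D: "1 \<le> D" "16 * D \<le> N" and b: "(\<Sum>j=1..n. b j) = N"
  shows "real (\<Sum>H | H \<in> avoiding Z \<and> (i, j) \<notin> H.
      card {(k, l). (i, l) \<in> H \<and> (k, j) \<in> H \<and> (k, l) \<in> H \<union> Z})
    \<le> 12 * real (a i * b j) * real D / N * card (avoiding Z)"
proof -
  let ?B = "{H \<in> avoiding Z. (i, j) \<notin> H}" and ?P = "{1..m} \<times> {1..n}"
  let ?R = "\<lambda>H p. (i, snd p) \<in> H \<and> (fst p, j) \<in> H"
  let ?q = "real (a i * b j)" and ?c = "real (card (avoiding Z))"
  have N: "real N > 0" using D by simp
  have finB: "finite ?B" using finite_avoiding by simp
  have finZ: "finite Z" using Z finite_X finite_subset by blast
  have "(\<Sum>H\<in>?B. card {(k, l). (i, l) \<in> H \<and> (k, j) \<in> H \<and> (k, l) \<in> H \<union> Z})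
      \<le> (\<Sum>H\<in>?B. card {p \<in> Z. ?R H p} + card {p \<in> ?P. ?R H p \<and> p \<in> H})"
  proof (rule sum_mono)
    fix H assume "H \<in> ?B"
    then have "H \<subseteq> ?P" using avoidingD(2) by blast
    then have "{(k, l). (i, l) \<in> H \<and> (k, j) \<in> H \<and> (k, l) \<in> H \<union> Z}
        \<subseteq> {p \<in> Z. ?R H p} \<union> {p \<in> ?P. ?R H p \<and> p \<in> H}" by auto
    then have "card {(k, l). (i, l) \<in> H \<and> (k, j) \<in> H \<and> (k, l) \<in> H \<union> Z}
        \<le> card ({p \<in> Z. ?R H p} \<union> {p \<in> ?P. ?R H p \<and> p \<in> H})"
      by (rule card_mono[rotated]) (use finZ in simp)
    also have "\<dots> \<le> card {p \<in> Z. ?R H p} + card {p \<in> ?P. ?R H p \<and> p \<in> H}"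
      by (rule card_Un_le)
    finally show "card {(k, l). (i, l) \<in> H \<and> (k, j) \<in> H \<and> (k, l) \<in> H \<union> Z}
        \<le> card {p \<in> Z. ?R H p} + card {p \<in> ?P. ?R H p \<and> p \<in> H}" .
  qed
  also have "\<dots> = (\<Sum>p\<in>Z. card {H \<in> ?B. ?R H p}) + (\<Sum>p\<in>?P. card {H \<in> ?B. ?R H p \<and> p \<in> H})"
    unfolding sum.distrib sum_card_swap[OF finB finZ]
    using sum_card_swap[OF finB, of ?P "\<lambda>H p. ?R H p \<and> p \<in> H"] by simp
  finally have "real (\<Sum>H\<in>?B. card {(k, l). (i, l) \<in> H \<and> (k, j) \<in> H \<and> (k, l) \<in> H \<union> Z})
      \<le> real (\<Sum>p\<in>Z. card {H \<in> ?B. ?R H p}) + real (\<Sum>p\<in>?P. card {H \<in> ?B. ?R H p \<and> p \<in> H})"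
    by (simp only: of_nat_add[symmetric] of_nat_le_iff)
  also have "real (\<Sum>p\<in>Z. card {H \<in> ?B. ?R H p})
      \<le> (\<Sum>(k, l)\<in>Z. 4 * ?q / real N ^ 2 * ?c * (real (a k) * real (b l)))"
    unfolding of_nat_sum
  proof (rule sum_mono, clarify)
    fix k l assume "(k, l) \<in> Z"
    then have "k \<in> {1..m}" "l \<in> {1..n}" using Z X_sub by auto
    from card_two_edges_le[OF Z ij this D]
    show "real (card {H \<in> ?B. (i, snd (k, l)) \<in> H \<and> (fst (k, l), j) \<in> H})
        \<le> 4 * ?q / real N ^ 2 * ?c * (real (a k) * real (b l))" by (simp add: mult_ac)
  qed
  also have "\<dots> = 4 * ?q / real N ^ 2 * ?c * F Z"
    by (simp add: F_def sum_distrib_left case_prod_unfold)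
  also have "\<dots> \<le> 4 * ?q / real N ^ 2 * ?c * (real N * real D)"
    by (intro mult_left_mono F_le[OF Z]) auto
  also have "real (\<Sum>p\<in>?P. card {H \<in> ?B. ?R H p \<and> p \<in> H})
      \<le> (\<Sum>(k, l)\<in>?P. 8 * ?q / real N ^ 3 * ?c * (real (a k) * real (b l)) ^ 2)"
    unfolding of_nat_sum
  proof (rule sum_mono, clarify)
    fix k l assume "k \<in> {1..m}" "l \<in> {1..n}"
    from card_three_edges_le[OF Z ij this D]
    show "real (card {H \<in> ?B. ((i, snd (k, l)) \<in> H \<and> (fst (k, l), j) \<in> H) \<and> (k, l) \<in> H})
        \<le> 8 * ?q / real N ^ 3 * ?c * (real (a k) * real (b l)) ^ 2" by (simp add: mult_ac conj_ac)
  qed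
  also have "\<dots> = 8 * ?q / real N ^ 3 * ?c * (\<Sum>(k, l)\<in>?P. (real (a k) * real (b l)) ^ 2)"
    by (simp add: sum_distrib_left case_prod_unfold)
  also have "\<dots> \<le> 8 * ?q / real N ^ 3 * ?c * (real D * real N ^ 2)"
    by (intro mult_left_mono sum_squares_le[OF b]) auto
  finally show ?thesis
    using N by (simp add: field_simps power2_eq_square power3_eq_cube)
qed

section \<open>Conditional edge probabilities and their telescoping product\<close>

lemma edge_probability:
  assumes Z: "Z \<subseteq> X" and ij: "i \<in> {1..m}" "j \<in> {1..n}" and e: "(i, j) \<notin> Z"
    and D: "1 \<le> D" "16 * D \<le> N" and b: "(\<Sum>j=1..n. b j) = N" and ne: "avoiding Z \<noteq> {}"
  defines "p \<equiv> real (count Z {(i, j)}) / card (avoiding Z)"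
  shows "p \<le> 2 * real (a i * b j) / N" "\<bar>p - real (a i * b j) / N\<bar> \<le> 14 * real (a i * b j) * real D / real N ^ 2"
proof -
  let ?A = "{H \<in> avoiding Z. (i, j) \<in> H}" and ?B = "{H \<in> avoiding Z. (i, j) \<notin> H}"
  let ?q = "real (a i * b j)" and ?c = "real (card (avoiding Z))"
  have N: "real N > 0" using D by simp
  have c: "?c > 0" using ne finite_avoiding by (simp add: card_gt_0_iff)
  have A: "count Z {(i, j)} = card ?A" by (simp add: count_def)
  have cA: "real (card ?A) = p * ?c" using c by (simp add: p_def A)
  have "card (avoiding Z) = card ?A + card ?B"
    by (subst card_Un_disjoint[symmetric]) (auto simp: finite_avoiding intro: arg_cong[of _ _ card])
  then have "?c = real (card ?A) + real (card ?B)" by simp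
  then have cB: "real (card ?B) = (1 - p) * ?c" using cA by (simp add: algebra_simps)
  have p0: "0 \<le> p" by (simp add: p_def)
  have "real (count Z (insert (i, j) {})) \<le> 2 * ?q / N * count Z {}"
    by (rule count_insert_ratio[OF Z ij]) (use D in auto)
  then show p2: "p \<le> 2 * ?q / N"
    using c by (simp add: p_def count_def field_simps)
  have qD: "?q \<le> D" by (intro of_nat_mono edge_weight_le ij)
  \<comment> \<open>Each graph with ij has at least N - 2D forward switchings, and each graph
    without it has at most a_i b_j reverse ones.\<close>
  have upper: "p * (real N - 2 * real D) \<le> ?q"
  proof -
    have "count Z {(i, j)} * (N - 2 * D) \<le> count Z {} * (a i * b j)"
      using count_insert_le[OF Z ij, of "{}"] by simp
    then have "real (count Z {(i, j)} * (N - 2 * D)) \<le> real (card (avoiding Z) * (a i * b j))"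
      unfolding of_nat_le_iff by (simp add: count_def)
    then have "p * ?c * (real N - 2 * real D) \<le> ?c * ?q"
      unfolding A of_nat_mult cA using D by (simp add: of_nat_diff)
    then show ?thesis using c by (simp add: mult_ac mult_le_cancel_left_pos)
  qed
  \<comment> \<open>Conversely, a graph without ij has exactly a_i b_j candidate pairs, each a
    reverse switching or blocked, and a graph with ij has at most N forward switchings. The blocked
    pairs are controlled only in total.\<close>
  have lower: "(1 - p) * ?q \<le> p * N + 12 * ?q * real D / N"
  proof -
    have "card ?B * (a i * b j) = (\<Sum>H\<in>?B. a i * b j)" by simp
    also have "\<dots> = (\<Sum>H\<in>?B. card {(k, l). (i, l) \<in> H \<and> (k, j) \<in> H})"
      by (rule sum.cong[OF refl], rule card_pairs[where Z = Z, OF _ ij, symmetric]) simp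
    also have "\<dots> \<le> (\<Sum>H\<in>?B. card (rev Z {} i j H)
        + card {(k, l). (i, l) \<in> H \<and> (k, j) \<in> H \<and> (k, l) \<in> H \<union> Z})"
    proof (rule sum_mono)
      fix H assume "H \<in> ?B"
      then have H: "H \<in> avoiding Z" by simp
      have "{(k, l). (i, l) \<in> H \<and> (k, j) \<in> H} = rev Z {} i j H
          \<union> {(k, l). (i, l) \<in> H \<and> (k, j) \<in> H \<and> (k, l) \<in> H \<union> Z}" by (auto simp: rev_def)
      then show "card {(k, l). (i, l) \<in> H \<and> (k, j) \<in> H} \<le> card (rev Z {} i j H)
          + card {(k, l). (i, l) \<in> H \<and> (k, j) \<in> H \<and> (k, l) \<in> H \<union> Z}"
        by (rule ord_eq_le_trans[OF arg_cong[where f = card] card_Un_le])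
    qed
    also have "\<dots> = (\<Sum>H\<in>?A. card (fwd Z {} i j H))
        + (\<Sum>H\<in>?B. card {(k, l). (i, l) \<in> H \<and> (k, j) \<in> H \<and> (k, l) \<in> H \<union> Z})"
      using switching_double_count[OF e, of "{}"] by (simp add: sum.distrib)
    also have "(\<Sum>H\<in>?A. card (fwd Z {} i j H)) \<le> (\<Sum>H\<in>?A. N)"
    proof (rule sum_mono)
      fix H assume "H \<in> ?A"
      then have H: "H \<in> avoiding Z" by simp
      have "card (fwd Z {} i j H) \<le> card H"
        by (rule card_mono[OF avoidingD(1)[OF H]]) (auto simp: fwd_def)
      then show "card (fwd Z {} i j H) \<le> N" using avoidingD(4)[OF H] by simp
    qed
    finally have "real (card ?B * (a i * b j)) \<le> real (card ?A * N
        + (\<Sum>H\<in>?B. card {(k, l). (i, l) \<in> H \<and> (k, j) \<in> H \<and> (k, l) \<in> H \<union> Z}))"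
      unfolding of_nat_le_iff by simp
    also have "\<dots> \<le> real (card ?A) * N + 12 * ?q * real D / N * ?c"
      using bad_reverse_switchings_le[OF Z ij D b] by simp
    finally have "((1 - p) * ?q) * ?c \<le> (p * N + 12 * ?q * real D / N) * ?c"
      unfolding of_nat_mult[of "card ?B"] cA cB by (simp add: algebra_simps)
    then show ?thesis using c by (simp only: mult_le_cancel_right_pos)
  qed
  have D': "16 * real D \<le> real N" using D by linarith
  \<comment> \<open>The crude bound p \<le> 2q/N is fed back into the error term 2Dp, which becomes
    4qD/N.\<close>
  have "p * N - ?q \<le> 2 * real D * p" using upper by (simp add: algebra_simps)
  also have "\<dots> \<le> 2 * real D * (2 * ?q / N)" by (intro mult_left_mono p2) auto
  finally have "p * N - ?q \<le> 4 * ?q * real D / N" by (simp add: mult_ac)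
  also have "\<dots> \<le> 14 * ?q * real D / N" by (intro divide_right_mono mult_right_mono) auto
  finally have 1: "p * N - ?q \<le> 14 * ?q * real D / N" .
  have "?q - p * N \<le> p * ?q + 12 * ?q * real D / N" using lower by (simp add: algebra_simps)
  \<comment> \<open>With q \<le> D this product is at most 2qD/N, which raises the constant 12 to
    14.\<close>
  also have "p * ?q \<le> 2 * ?q / N * D" using p2 qD p0 by (intro mult_mono) auto
  finally have 2: "?q - p * N \<le> 14 * ?q * real D / N" by (simp add: field_simps)
  have "\<bar>p * N - ?q\<bar> / N \<le> (14 * ?q * real D / N) / N"
    using 1 2 N by (intro divide_right_mono) auto
  moreover have "p - ?q / N = (p * N - ?q) / N" using N by (simp add: field_simps)
  then have "\<bar>p - ?q / N\<bar> = \<bar>p * N - ?q\<bar> / N" by (simp only: abs_divide abs_of_nat)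
  ultimately show "\<bar>p - ?q / N\<bar> \<le> 14 * ?q * real D / real N ^ 2"
    by (simp add: power2_eq_square)
qed

text \<open>The ratio is 1 - p, and ln(1 - p) differs from -p by at most 2p^2 because p \<le> 1/2.
  Bounding one factor p by 2q/N and the other by 2D/N makes this 8qD/N^2; adding the 14 from
  \<open>edge_probability\<close> gives 22.\<close>

lemma avoiding_insert_ratio:
  assumes Z: "Z \<subseteq> X" and ij: "(i, j) \<in> X" and e: "(i, j) \<notin> Z"
    and D: "1 \<le> D" "16 * D \<le> N" and b: "(\<Sum>j=1..n. b j) = N" and ne: "avoiding Z \<noteq> {}"
  defines "r \<equiv> real (card (avoiding (insert (i, j) Z))) / card (avoiding Z)"
  shows "0 < r" "\<bar>ln r + real (a i * b j) / N\<bar> \<le> 22 * real (a i * b j) * real D / real N ^ 2"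
proof -
  have ij': "i \<in> {1..m}" "j \<in> {1..n}" using ij X_sub by auto
  let ?q = "real (a i * b j)" and ?c = "real (card (avoiding Z))"
  define p where "p = real (count Z {(i, j)}) / ?c"
  note ep = edge_probability[OF Z ij' e D b ne, folded p_def]
  have N: "real N > 0" using D by simp
  have D': "16 * real D \<le> real N" using D by linarith
  have c: "?c > 0" using ne finite_avoiding by (simp add: card_gt_0_iff)
  have "avoiding (insert (i, j) Z) = avoiding Z - {H \<in> avoiding Z. {(i, j)} \<subseteq> H}"
    by (auto simp: avoiding_def)
  then have "card (avoiding (insert (i, j) Z)) = card (avoiding Z) - count Z {(i, j)}"
    unfolding count_def by (simp only:) (rule card_Diff_subset, auto simp: finite_avoiding)
  moreover have "count Z {(i, j)} \<le> card (avoiding Z)"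
    unfolding count_def by (rule card_mono) (auto simp: finite_avoiding)
  ultimately have r: "r = 1 - p"
    using c by (simp add: r_def p_def of_nat_diff diff_divide_distrib)
  have p0: "0 \<le> p" by (simp add: p_def)
  have qD: "?q \<le> D" by (intro of_nat_mono edge_weight_le ij')
  have p3: "p \<le> 2 * real D / N"
    using ep(1) qD N by (smt (verit) divide_right_mono of_nat_0_le_iff)
  have "2 * real D / N \<le> 1 / 2" using D' N by (simp add: field_simps)
  then have p4: "p \<le> 1 / 2" using p3 by linarith
  show "0 < r" using p4 r by simp
  have "\<bar>ln (1 + (- p)) - (- p)\<bar> \<le> 2 * (- p) ^ 2"
    by (rule abs_ln_one_plus_x_minus_x_bound) (use p0 p4 in auto)
  then have "\<bar>ln r + p\<bar> \<le> 2 * (p * p)" by (simp add: r power2_eq_square)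
  also have "p * p \<le> (2 * ?q / N) * (2 * real D / N)" by (rule mult_mono) (use ep(1) p3 p0 in auto)
  also have "2 * ((2 * ?q / N) * (2 * real D / N)) = 8 * ?q * real D / real N ^ 2" by (simp add: power2_eq_square)
  finally have "\<bar>ln r + ?q / N\<bar> \<le> 8 * ?q * real D / real N ^ 2 + 14 * ?q * real D / real N ^ 2"
    using ep(2) by linarith
  then show "\<bar>ln r + ?q / N\<bar> \<le> 22 * ?q * real D / real N ^ 2" by (simp add: add_divide_distrib[symmetric])
qed

lemma avoiding_probability:
  assumes D: "1 \<le> D" "16 * D \<le> N" and b: "(\<Sum>j=1..n. b j) = N" and ne: "avoiding {} \<noteq> {}"
    and Z: "Z \<subseteq> X"
  shows "avoiding Z \<noteq> {} \<and>
    \<bar>ln (real (card (avoiding Z)) / card (avoiding {})) + F Z / N\<bar> \<le> 22 * F Z * real D / real N ^ 2"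
proof -
  have "finite Z" using Z finite_X finite_subset by blast
  then show ?thesis using Z
  \<comment> \<open>Nonemptiness is part of the induction claim: the next conditional probability is
    defined only if some graph avoids the edges treated so far. The error bounds add up because
    \<open>F\<close> is additive over edges.\<close>
  proof (induction Z rule: finite_induct)
    case empty
    have "card (avoiding {}) \<noteq> 0" using ne finite_avoiding by simp
    then show ?case using ne by (simp add: F_def)
  next
    case (insert e Z)
    obtain i j where e: "e = (i, j)" by (cases e)
    have Z: "Z \<subseteq> X" "(i, j) \<in> X" "(i, j) \<notin> Z" using insert e by auto
    have IH: "avoiding Z \<noteq> {}"
      "\<bar>ln (real (card (avoiding Z)) / card (avoiding {})) + F Z / N\<bar> \<le> 22 * F Z * real D / real N ^ 2"
      using insert Z by auto
    let ?q = "real (a i * b j)"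
    let ?r = "real (card (avoiding (insert e Z))) / card (avoiding Z)"
    let ?P = "real (card (avoiding Z)) / card (avoiding {})"
    note ratio = avoiding_insert_ratio[OF Z D b IH(1), folded e]
    have pos: "real (card (avoiding {})) > 0" "real (card (avoiding Z)) > 0"
      using ne IH(1) finite_avoiding by (simp_all add: card_gt_0_iff)
    have "real (card (avoiding (insert e Z))) / card (avoiding {}) = ?r * ?P"
      using pos by simp
    then have "ln (real (card (avoiding (insert e Z))) / card (avoiding {})) = ln ?r + ln ?P"
      using ratio(1) pos by (simp only:) (rule ln_mult_pos, auto)
    moreover have F: "F (insert e Z) = ?q + F Z"
      using insert by (simp add: F_def e)
    ultimately have "\<bar>ln (real (card (avoiding (insert e Z))) / card (avoiding {})) + F (insert e Z) / N\<bar>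
        \<le> 22 * ?q * real D / real N ^ 2 + 22 * F Z * real D / real N ^ 2"
      using ratio(2) IH(2) by (simp add: add_divide_distrib)
    also have "\<dots> = 22 * F (insert e Z) * real D / real N ^ 2"
      by (simp add: F add_divide_distrib[symmetric] algebra_simps)
    finally show ?case using ratio(1) by auto
  qed
qed

end

section \<open>Reduction to the residual degrees\<close>

lemma card_bip_graphs_containing:
  assumes X: "X \<subseteq> {1..m} \<times> {1..n}"
  shows "card {G \<in> bip_graphs m n (\<lambda>i. int (s i)) (\<lambda>j. int (t j)). X \<subseteq> G}
    = card {H \<in> bip_graphs m n (s_res s X) (t_res t X). H \<inter> X = {}}"
proof (rule bij_betw_same_card)
  have finX: "finite X" using X by (rule finite_subset) auto
  let ?G = "{G \<in> bip_graphs m n (\<lambda>i. int (s i)) (\<lambda>j. int (t j)). X \<subseteq> G}"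
  let ?H = "{H \<in> bip_graphs m n (s_res s X) (t_res t X). H \<inter> X = {}}"
  show "bij_betw (\<lambda>G. G - X) ?G ?H"
  proof (rule bij_betw_byWitness[where f' = "\<lambda>H. H \<union> X"])
    show "\<forall>G\<in>?G. (G - X) \<union> X = G" by auto
    show "\<forall>H\<in>?H. (H \<union> X) - X = H" by auto
    show "(\<lambda>G. G - X) ` ?G \<subseteq> ?H"
    proof (rule image_subsetI)
      fix G assume "G \<in> ?G"
      then have G: "G \<in> bip_graphs m n (\<lambda>i. int (s i)) (\<lambda>j. int (t j))" "X \<subseteq> G" by auto
      have "finite (G - X)" using bip_graphs_finite_graph[OF G(1)] by simp
      then have "udeg G i = udeg (G - X) i + udeg X i" "vdeg G i = vdeg (G - X) i + vdeg X i" for i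
        using udeg_Un_disjoint[of "G - X" X i] vdeg_Un_disjoint[of "G - X" X i] finX G(2)
        by (simp_all add: Un_absorb2 Int_commute)
      then show "G - X \<in> ?H"
        using G(1) by (auto simp: bip_graphs_def s_res_def t_res_def)
    qed
    show "(\<lambda>H. H \<union> X) ` ?H \<subseteq> ?G"
    proof (rule image_subsetI)
      fix H assume "H \<in> ?H"
      then have H: "H \<in> bip_graphs m n (s_res s X) (t_res t X)" "H \<inter> X = {}" by auto
      have "udeg (H \<union> X) i = udeg H i + udeg X i" "vdeg (H \<union> X) i = vdeg H i + vdeg X i" for i
        using udeg_Un_disjoint vdeg_Un_disjoint bip_graphs_finite_graph[OF H(1)] finX H(2) by auto
      then show "H \<union> X \<in> ?G"
        using H(1) X by (auto simp: bip_graphs_def s_res_def t_res_def)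
    qed
  qed
qed

lemma bip_graphs_cong:
  assumes "\<And>i. i \<in> {1..m} \<Longrightarrow> s i = s' i" "\<And>j. j \<in> {1..n} \<Longrightarrow> t j = t' j"
  shows "bip_graphs m n s t = bip_graphs m n s' t'"
  using assms by (simp add: bip_graphs_def)

lemma Max_of_nat_image:
  assumes "finite A" "A \<noteq> {}" "\<And>x. x \<in> A \<Longrightarrow> f x = int (g x)"
  shows "Max (f ` A) = int (Max (g ` A))"
proof -
  have "f ` A = int ` g ` A" using assms(3) by (auto simp: image_image)
  then show ?thesis
    using mono_Max_commute[of int "g ` A"] assms(1,2) by (simp add: mono_def)
qed

text \<open>\<open>P\<close> is the probability that a uniform graph with the residual degrees
  avoids X. The locale is instantiated with the actual maxima, and its estimates are transferred to
  the integer and real quantities of the statement.\<close>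

lemma containment_probability:
  assumes degree_sums: "(\<Sum>i=1..m. s i) = (\<Sum>j=1..n. t j)"
    and X: "X \<subseteq> {1..m} \<times> {1..n}"
    and res: "bip_graphs m n (s_res s X) (t_res t X) \<noteq> {}"
    and S: "1 \<le> S_hat m s X" and small: "16 * delta_hat_max m n s t X \<le> S_hat m s X"
  defines "P \<equiv> real (card {G \<in> bip_graphs m n (\<lambda>i. int (s i)) (\<lambda>j. int (t j)). X \<subseteq> G})
    / num_bip_graphs m n (s_res s X) (t_res t X)"
  shows "0 < P"
    "\<bar>ln P + F_hat s t X / S_hat m s X\<bar> \<le> 22 * F_hat s t X * delta_hat_max m n s t X / S_hat m s X ^ 2"
    "0 \<le> F_hat s t X" "F_hat s t X \<le> S_hat m s X * delta_hat_max m n s t X"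
    "0 \<le> delta_hat_max m n s t X"
proof -
  define a where "a = (\<lambda>i. nat (s_res s X i))"
  define b where "b = (\<lambda>j. nat (t_res t X j))"
  obtain H where H: "H \<in> bip_graphs m n (s_res s X) (t_res t X)" using res by auto
  \<comment> \<open>A residual graph exists, so residual degrees are nonnegative and
    \<open>nat\<close> truncates nothing.\<close>
  have a: "s_res s X i = int (a i)" if "i \<in> {1..m}" for i
  proof -
    have "s_res s X i = int (udeg H i)" using H that by (simp add: bip_graphs_def)
    then show ?thesis by (simp add: a_def)
  qed
  have b: "t_res t X j = int (b j)" if "j \<in> {1..n}" for j
  proof -
    have "t_res t X j = int (vdeg H j)" using H that by (simp add: bip_graphs_def)
    then show ?thesis by (simp add: b_def)
  qed
  have bip: "bip_graphs m n (s_res s X) (t_res t X) = bip_graphs m n (\<lambda>i. int (a i)) (\<lambda>j. int (b j))"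
    by (rule bip_graphs_cong) (use a b in auto)
  have "int (\<Sum>i=1..m. a i) = (\<Sum>i=1..m. int (s i) - int (udeg X i))"
    unfolding of_nat_sum by (rule sum.cong) (use a in \<open>auto simp: s_res_def\<close>)
  then have sum_a: "int (\<Sum>i=1..m. a i) = int (\<Sum>i=1..m. s i) - int (card X)"
    using card_eq_sum_udeg[OF X] by (simp add: sum_subtractf)
  have "int (\<Sum>j=1..n. b j) = (\<Sum>j=1..n. int (t j) - int (vdeg X j))"
    unfolding of_nat_sum by (rule sum.cong) (use b in \<open>auto simp: t_res_def\<close>)
  then have sum_b: "int (\<Sum>j=1..n. b j) = int (\<Sum>j=1..n. t j) - int (card X)"
    using card_eq_sum_vdeg[OF X] by (simp add: sum_subtractf)
  have ab: "(\<Sum>j=1..n. b j) = (\<Sum>i=1..m. a i)" using sum_a sum_b degree_sums by linarith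
  have S_eq: "S_hat m s X = real (\<Sum>i=1..m. a i)" unfolding S_hat_def using sum_a by linarith
  \<comment> \<open>\<open>Max\<close> is meaningful only on nonempty ranges; a positive degree sum
    guarantees both.\<close>
  have "m \<noteq> 0" using S S_eq by (intro notI) simp
  then have m: "{1..m} \<noteq> {}" by auto
  have "n \<noteq> 0" using S S_eq ab by (intro notI) simp
  then have n: "{1..n} \<noteq> {}" by auto
  define \<alpha> where "\<alpha> = Max (a ` {1..m})"
  define \<beta> where "\<beta> = Max (b ` {1..n})"
  define \<xi> where "\<xi> = Max (udeg X ` {1..m})"
  define \<eta> where "\<eta> = Max (vdeg X ` {1..n})"
  interpret bipartite_degrees m n a b \<alpha> \<beta> \<xi> \<eta> X
    by unfold_locales (use X in \<open>auto simp: \<alpha>_def \<beta>_def \<xi>_def \<eta>_def\<close>)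
  have N: "S_hat m s X = real N" by (simp add: S_eq N_def)
  have "s_hat_max m s X = \<alpha>" "t_hat_max n t X = \<beta>" "x_max m X = \<xi>" "y_max n X = \<eta>"
    using Max_of_nat_image[OF finite_atLeastAtMost m a] Max_of_nat_image[OF finite_atLeastAtMost n b]
    by (simp_all add: s_hat_max_def t_hat_max_def x_max_def y_max_def \<alpha>_def \<beta>_def \<xi>_def \<eta>_def)
  then have D: "delta_hat_max m n s t X = real D"
    by (simp add: delta_hat_max_def D_def)
  have F: "F_hat s t X = F X"
    unfolding F_hat_def F_def using X a b by (intro sum.cong) auto
  have ne: "avoiding {} \<noteq> {}" using res bip by (simp add: avoiding_def)
  have H': "H \<in> avoiding {}" using H bip by (simp add: avoiding_def)
  \<comment> \<open>D \<ge> 1 comes from any edge of a residual graph: both of its endpoints have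
    positive degree.\<close>
  have "card H \<noteq> 0" using avoidingD(4)[OF H'] S N by auto
  then have "H \<noteq> {}" by auto
  then obtain i j where ij: "(i, j) \<in> H" by auto
  then have ij': "i \<in> {1..m}" "j \<in> {1..n}" using avoidingD(2)[OF H'] by auto
  have "udeg H i \<noteq> 0" "vdeg H j \<noteq> 0"
    using ij udeg_finite[OF avoidingD(1)[OF H']] vdeg_finite[OF avoidingD(1)[OF H']]
    by (auto simp: udeg_def vdeg_def)
  then have "1 \<le> a i * b j" using avoidingD(5,6)[OF H'] ij' by (simp add: Suc_le_eq)
  then have D1: "1 \<le> D" using edge_weight_le[OF ij'] by linarith
  have DN: "16 * D \<le> N" using small unfolding D N by linarith
  have P: "P = real (card (avoiding X)) / card (avoiding {})"
    unfolding P_def card_bip_graphs_containing[OF X] num_bip_graphs_def bip avoiding_def by simp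
  have main: "avoiding X \<noteq> {}" "\<bar>ln P + F X / N\<bar> \<le> 22 * F X * D / N ^ 2"
    using avoiding_probability[OF D1 DN _ ne order_refl] ab unfolding P N_def by auto
  show "0 < P" using main(1) ne finite_avoiding unfolding P by (simp add: card_gt_0_iff)
  show "\<bar>ln P + F_hat s t X / S_hat m s X\<bar>
      \<le> 22 * F_hat s t X * delta_hat_max m n s t X / S_hat m s X ^ 2"
    using main(2) unfolding F N D by simp
  show "0 \<le> F_hat s t X" unfolding F F_def by (auto intro!: sum_nonneg)
  show "F_hat s t X \<le> S_hat m s X * delta_hat_max m n s t X"
    using F_le[OF order_refl] unfolding F N D .
  show "0 \<le> delta_hat_max m n s t X" unfolding D by simp
qed

section \<open>The asymptotic formula\<close>

theorem corollary2p7: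
  fixes L :: "'k filter"
    and m n :: "'k \<Rightarrow> nat"
    and s t :: "'k \<Rightarrow> nat \<Rightarrow> nat"
    and X :: "'k \<Rightarrow> (nat \<times> nat) set"
  assumes degree_sums: "\<And>k. (\<Sum>i=1..m k. s k i) = (\<Sum>j=1..n k. t k j)"
    and X_subset: "\<And>k. X k \<subseteq> {1..m k} \<times> {1..n k}"
    and nonempty: "\<And>k. bip_graphs (m k) (n k) (\<lambda>i. int (s k i)) (\<lambda>j. int (t k j)) \<noteq> {}"
    and S_hat_limit: "filterlim (\<lambda>k. S_hat (m k) (s k) (X k)) at_top L"
    and max_small:
      "(\<lambda>k. s_hat_max (m k) (s k) (X k) + t_hat_max (n k) (t k) (X k))
         \<in> o[L](\<lambda>k. S_hat (m k) (s k) (X k) / ln (S_hat (m k) (s k) (X k)))"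
    and delta_small:
      "(\<lambda>k. delta_hat_max (m k) (n k) (s k) (t k) (X k))
         \<in> o[L](\<lambda>k. S_hat (m k) (s k) (X k))"
    and delta_F_small:
      "(\<lambda>k. delta_hat_max (m k) (n k) (s k) (t k) (X k) * F_hat (s k) (t k) (X k))
         \<in> o[L](\<lambda>k. S_hat (m k) (s k) (X k) ^ 2)"
    and F_small:
      "(\<lambda>k. F_hat (s k) (t k) (X k))
         \<in> o[L](\<lambda>k. S_hat (m k) (s k) (X k) powr (5 / 3))"
  shows
    "\<exists>err :: 'k \<Rightarrow> real.
       err \<in> O[L](\<lambda>k.
         delta_hat_max (m k) (n k) (s k) (t k) (X k) * F_hat (s k) (t k) (X k)
             / S_hat (m k) (s k) (X k) ^ 2
           + F_hat (s k) (t k) (X k) ^ 3 / S_hat (m k) (s k) (X k) ^ 5) \<and>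
       (\<forall>\<^sub>F k in L.
         measure_pmf.prob
             (pmf_of_set (bip_graphs (m k) (n k) (\<lambda>i. int (s k i)) (\<lambda>j. int (t k j))))
             {G. X k \<subseteq> G}
         = real (num_bip_graphs (m k) (n k) (s_res (s k) (X k)) (t_res (t k) (X k)))
             / real (num_bip_graphs (m k) (n k) (\<lambda>i. int (s k i)) (\<lambda>j. int (t k j)))
           * exp (- (F_hat (s k) (t k) (X k) / S_hat (m k) (s k) (X k))
                  - 3 * F_hat (s k) (t k) (X k) ^ 2 / (2 * S_hat (m k) (s k) (X k) ^ 3)
                  + err k))"
proof -
  let ?S = "\<lambda>k. S_hat (m k) (s k) (X k)" and ?F = "\<lambda>k. F_hat (s k) (t k) (X k)"
  let ?d = "\<lambda>k. delta_hat_max (m k) (n k) (s k) (t k) (X k)"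
  let ?B = "\<lambda>k. bip_graphs (m k) (n k) (\<lambda>i. int (s k i)) (\<lambda>j. int (t k j))"
  let ?R = "\<lambda>k. bip_graphs (m k) (n k) (s_res (s k) (X k)) (t_res (t k) (X k))"
  define P where "P k = real (card {G \<in> ?B k. X k \<subseteq> G})
    / num_bip_graphs (m k) (n k) (s_res (s k) (X k)) (t_res (t k) (X k))" for k
  \<comment> \<open>Without residual graphs both sides vanish, but \<open>F_hat\<close> may be negative.\<close>
  define err where "err k = (if ?R k = {} then 0
    else ln (P k) + ?F k / ?S k + 3 * ?F k ^ 2 / (2 * ?S k ^ 3))" for k
  have "\<forall>\<^sub>F k in L. 1 \<le> ?S k"
    using S_hat_limit by (simp add: filterlim_at_top)
  \<comment> \<open>The constant 1/16 matches the smallness condition of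
    \<open>containment_probability\<close>.\<close>
  moreover have "\<forall>\<^sub>F k in L. norm (?d k) \<le> 1 / 16 * norm (?S k)"
    using delta_small by (rule landau_o.smallD) simp
  ultimately have ev: "\<forall>\<^sub>F k in L. 1 \<le> ?S k \<and> 16 * ?d k \<le> ?S k"
    by eventually_elim auto
  have bound: "norm (err k) \<le> 24 * norm (?d k * ?F k / ?S k ^ 2 + ?F k ^ 3 / ?S k ^ 5)"
    if S: "1 \<le> ?S k \<and> 16 * ?d k \<le> ?S k" for k
  proof (cases "?R k = {}")
    case True
    then show ?thesis by (simp add: err_def)
  next
    case False
    note c = containment_probability[OF degree_sums[of k] X_subset[of k] False conjunct1[OF S]
        conjunct2[OF S], folded P_def]
    have S0: "?S k > 0" using S by linarith
    \<comment> \<open>By F \<le> S \<delta> the quadratic term in the exponent is of the order of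
      the first error term, so \<open>err\<close> can absorb it.\<close>
    have sq: "?F k ^ 2 / ?S k ^ 3 \<le> ?d k * ?F k / ?S k ^ 2"
    proof -
      have "?F k ^ 2 \<le> (?S k * ?d k) * ?F k"
        unfolding power2_eq_square by (rule mult_right_mono[OF c(4,3)])
      then have "?F k ^ 2 / ?S k ^ 3 \<le> (?S k * ?d k) * ?F k / ?S k ^ 3"
        by (rule divide_right_mono) (use S0 in simp)
      then show ?thesis using S0 by (simp add: power2_eq_square power3_eq_cube)
    qed
    have pos: "0 \<le> ?F k ^ 2 / ?S k ^ 3" "0 \<le> ?F k ^ 3 / ?S k ^ 5" "0 \<le> ?d k * ?F k / ?S k ^ 2"
      using c(3,5) S0 by auto
    have "err k = ln (P k) + ?F k / ?S k + 3 / 2 * (?F k ^ 2 / ?S k ^ 3)"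
      using False by (simp add: err_def)
    moreover have "\<bar>ln (P k) + ?F k / ?S k\<bar> \<le> 22 * (?d k * ?F k / ?S k ^ 2)"
      using c(2) by (simp add: mult_ac)
    \<comment> \<open>The constant 24 covers 22 from the logarithm and 3/2 from the quadratic term;
      the cubic term enters only as a nonnegative summand.\<close>
    moreover have "\<bar>x + 3 / 2 * y\<bar> \<le> 24 * (z + w)"
      if "\<bar>x\<bar> \<le> 22 * z" "y \<le> z" "0 \<le> y" "0 \<le> w" for x y z w :: real
      using that by (simp add: abs_le_iff)
    ultimately have "\<bar>err k\<bar> \<le> 24 * (?d k * ?F k / ?S k ^ 2 + ?F k ^ 3 / ?S k ^ 5)"
      using sq pos(1,2) by simp
    then show ?thesis using pos by simp
  qed
  have "err \<in> O[L](\<lambda>k. ?d k * ?F k / ?S k ^ 2 + ?F k ^ 3 / ?S k ^ 5)"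
    by (rule bigoI[where c = 24]) (use ev bound in \<open>auto elim: eventually_mono\<close>)
  moreover have "\<forall>\<^sub>F k in L. measure_pmf.prob (pmf_of_set (?B k)) {G. X k \<subseteq> G}
      = real (num_bip_graphs (m k) (n k) (s_res (s k) (X k)) (t_res (t k) (X k)))
          / real (num_bip_graphs (m k) (n k) (\<lambda>i. int (s k i)) (\<lambda>j. int (t k j)))
        * exp (- (?F k / ?S k) - 3 * ?F k ^ 2 / (2 * ?S k ^ 3) + err k)"
    using ev
  proof eventually_elim
    case (elim k)
    let ?c = "real (card {G \<in> ?B k. X k \<subseteq> G})"
    have prob: "measure_pmf.prob (pmf_of_set (?B k)) {G. X k \<subseteq> G}
        = ?c / num_bip_graphs (m k) (n k) (\<lambda>i. int (s k i)) (\<lambda>j. int (t k j))"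
      using measure_pmf_of_set[OF nonempty[of k] finite_bip_graphs, of "{G. X k \<subseteq> G}"]
      by (simp add: num_bip_graphs_def Int_def)
    show ?case
    proof (cases "?R k = {}")
      case True
      then have "?c = 0" "num_bip_graphs (m k) (n k) (s_res (s k) (X k)) (t_res (t k) (X k)) = 0"
        using card_bip_graphs_containing[OF X_subset[of k], of "s k" "t k"]
        by (simp_all add: num_bip_graphs_def)
      then show ?thesis unfolding prob by simp
    next
      case False
      note c = containment_probability[OF degree_sums[of k] X_subset[of k] False conjunct1[OF elim]
          conjunct2[OF elim], folded P_def]
      have "num_bip_graphs (m k) (n k) (s_res (s k) (X k)) (t_res (t k) (X k)) \<noteq> 0"
        using False finite_bip_graphs by (simp add: num_bip_graphs_def)
      then have "?c = num_bip_graphs (m k) (n k) (s_res (s k) (X k)) (t_res (t k) (X k)) * P k"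
        by (simp add: P_def)
      moreover have "exp (- (?F k / ?S k) - 3 * ?F k ^ 2 / (2 * ?S k ^ 3) + err k) = P k"
        using False c(1) by (simp add: err_def)
      ultimately show ?thesis unfolding prob by simp
    qed
  qed
  ultimately show ?thesis by blast
qed

end
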